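(* Let $K$ be a finite field of odd characteristic and $d:V\times V\to K$ a non-degenerate symmetric bilinear form with $n=\dim V$. Let $\mathcal{X},\mathcal{Y}$ be orthogonal bases of $d$ (viewed as sets of $1$-dimensional subspaces) with addresses $(n-s:s)$ and $(n-r:r)$ respectively. (i) If $n$ is odd, then $\mathcal{X}\varphi=\mathcal{Y}$ for some $(\varphi,\hat\varphi)\in\operatorname{Isom}^*(d)$ if and only if $s=r$. (ii) If $n$ is even, then $\mathcal{X}\varphi=\mathcal{Y}$ for some $(\varphi,\hat\varphi)\in\operatorname{Isom}^*(d)$ if and only if $s=r$ or $s=n-r$.
   Context: An orthogonal basis of $d$ is a basis $\{x_1,\dots,x_n\}$ of $V$ with $d(x_i,x_j)=0$ for $i\ne j$; it is identified with the set $\{\langle x_i\rangle\}$ of lines, and $\mathcal{X}\varphi=\{X\varphi:X\in\mathcal{X}\}$. Its address is $(n-s:s)$ where $s$ is the number of $i$ for which $d(x_i,x_i)$ is a non-square in $K$. $\operatorname{Isom}^*(d)=\{(\varphi,\hat\varphi)\in\mathrm{GL}(V)\times K^\times: d(u\varphi,v\varphi)=\hat\varphi\, d(u,v)\ \forall u,v\}$. *)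

theory Defs
  imports "HOL-Analysis.Cartesian_Space"
begin

text \<open>The space V is modelled as K^n = 'k^'n with n = CARD('n).\<close>

definition bilinear_form :: "('k::field^'n \<Rightarrow> 'k^'n \<Rightarrow> 'k) \<Rightarrow> bool" where
  "bilinear_form d \<longleftrightarrow>
     (\<forall>u v w. d (u + v) w = d u w + d v w) \<and>
     (\<forall>u v w. d u (v + w) = d u v + d u w) \<and>
     (\<forall>a u v. d (a *s u) v = a * d u v) \<and>
     (\<forall>a u v. d u (a *s v) = a * d u v)"

definition symmetric_form :: "('k::field^'n \<Rightarrow> 'k^'n \<Rightarrow> 'k) \<Rightarrow> bool" where
  "symmetric_form d \<longleftrightarrow> (\<forall>u v. d u v = d v u)"

definition nondegenerate_form :: "('k::field^'n \<Rightarrow> 'k^'n \<Rightarrow> 'k) \<Rightarrow> bool" where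
  "nondegenerate_form d \<longleftrightarrow> (\<forall>u. (\<forall>v. d u v = 0) \<longrightarrow> u = 0)"

text \<open>An orthogonal basis of d, given by its vectors.\<close>
definition orthogonal_basis :: "('k::field^'n \<Rightarrow> 'k^'n \<Rightarrow> 'k) \<Rightarrow> ('k^'n) set \<Rightarrow> bool" where
  "orthogonal_basis d B \<longleftrightarrow> vec.independent B \<and> vec.span B = UNIV \<and>
     (\<forall>x\<in>B. \<forall>y\<in>B. x \<noteq> y \<longrightarrow> d x y = 0)"

text \<open>The set of 1-dimensional subspaces spanned by the basis vectors.\<close>
definition basis_lines :: "('k::field^'n) set \<Rightarrow> ('k^'n) set set" where
  "basis_lines B = (\<lambda>x. vec.span {x}) ` B"

text \<open>The number s in the address (n-s:s): basis vectors x with d(x,x) a non-square.\<close>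
definition address_nonsquares :: "('k::field^'n \<Rightarrow> 'k^'n \<Rightarrow> 'k) \<Rightarrow> ('k^'n) set \<Rightarrow> nat" where
  "address_nonsquares d B = card {x\<in>B. \<not> (\<exists>y. d x x = y ^ 2)}"

definition Isom_star :: "('k::field^'n \<Rightarrow> 'k^'n \<Rightarrow> 'k) \<Rightarrow> (('k^'n \<Rightarrow> 'k^'n) \<times> 'k) set" where
  "Isom_star d = {(\<phi>, c). Vector_Spaces.linear (*s) (*s) \<phi> \<and> bij \<phi> \<and> c \<noteq> 0 \<and>
                        (\<forall>u v. d (\<phi> u) (\<phi> v) = c * d u v)}"

end

theory Submission
  imports Defs "HOL-Analysis.Determinants" "HOL-Computational_Algebra.Nth_Powers"
begin

text \<open>
  A similitude \<open>\<phi>\<close> with multiplier \<open>c\<close> that maps the lines of \<open>B\<close> onto those of \<open>C\<close>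
  sends each \<open>x \<in> B\<close> to a multiple of some \<open>\<sigma> x \<in> C\<close>, so \<open>c d(x,x)\<close> and \<open>d(\<sigma> x, \<sigma> x)\<close>
  differ by a square. As the nonzero squares have index 2 in the multiplicative group of a
  finite field, \<open>\<sigma>\<close> preserves the square classes of the diagonal entries if \<open>c\<close> is a
  square and swaps them otherwise. Conversely, every bijection \<open>B \<rightarrow> C\<close> with this property
  becomes a similitude after rescaling the images. Comparing Gram determinants shows that
  \<open>c\<^sup>n\<close> is a square, which rules out nonsquare multipliers in odd dimension, while in odd
  characteristic nonsquares exist.
\<close>

lemma is_square_mult_cancel_left:
  fixes a b :: "'k::field"
  assumes "is_square a" and "a \<noteq> 0"
  shows "is_square (a * b) \<longleftrightarrow> is_square b"
proof
  obtain u where u: "a = u ^ 2" using assms(1) by (elim is_nth_powerE)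
  assume "is_square (a * b)"
  then obtain w where "a * b = w ^ 2" by (elim is_nth_powerE)
  then have "b = (w / u) ^ 2" using u assms(2) by (simp add: power_divide field_simps)
  then show "is_square b" by (rule is_nth_powerI)
qed (use assms in \<open>auto intro: is_nth_power_mult\<close>)

lemma card_nonzero_le_twice_card_squares:
  assumes "finite (UNIV :: 'k::field set)"
  shows "card (- {0 :: 'k}) \<le> 2 * card ((\<lambda>x. x ^ 2) ` (- {0 :: 'k}))"
proof -
  let ?sq = "\<lambda>x::'k. x ^ 2"
  let ?U = "- {0 :: 'k}"
  let ?S = "?sq ` ?U"
  let ?rt = "inv_into ?U ?sq"
  have "?U \<subseteq> ?rt ` ?S \<union> (\<lambda>s. - ?rt s) ` ?S"
  proof
    fix x assume x: "x \<in> ?U"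
    then have "?sq (?rt (?sq x)) = ?sq x" by (intro f_inv_into_f) auto
    then have "x = ?rt (?sq x) \<or> x = - ?rt (?sq x)" by (auto simp: power2_eq_iff)
    then show "x \<in> ?rt ` ?S \<union> (\<lambda>s. - ?rt s) ` ?S" using x by blast
  qed
  then have "card ?U \<le> card (?rt ` ?S \<union> (\<lambda>s. - ?rt s) ` ?S)"
    using assms by (intro card_mono) auto
  also have "\<dots> \<le> card (?rt ` ?S) + card ((\<lambda>s. - ?rt s) ` ?S)" by (rule card_Un_le)
  also have "\<dots> \<le> card ?S + card ?S"
    using assms by (intro add_mono card_image_le) auto
  finally show ?thesis by simp
qed

lemma nonsquare_mult_nonsquare:
  fixes a b :: "'k::field"
  assumes "finite (UNIV :: 'k set)" and "\<not> is_square a" and "\<not> is_square b"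
  shows "is_square (a * b)"
proof -
  let ?U = "- {0 :: 'k}"
  let ?S = "(\<lambda>x. x ^ 2) ` ?U"
  let ?N = "?U - ?S"
  have fin: "finite ?U" "finite ?S" using assms(1) by (auto intro: finite_subset)
  have "card ?N = card ?U - card ?S"
    using fin by (intro card_Diff_subset) auto
  then have "card ?N \<le> card ?S"
    using card_nonzero_le_twice_card_squares[OF assms(1)] by linarith
  have a0: "a \<noteq> 0" using assms(2) by auto
  \<comment> \<open>multiplication by \<open>a\<close> maps the nonzero squares injectively into the no more
     numerous nonsquares, hence onto them\<close>
  have scaled: "(*) a ` ?S \<subseteq> ?N"
  proof
    fix z assume "z \<in> (*) a ` ?S"
    then obtain x where x: "x \<noteq> 0" "z = a * x ^ 2" by auto
    have "z \<notin> ?S"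
    proof
      assume "z \<in> ?S"
      then obtain y where "a * x ^ 2 = y ^ 2" using x(2) by auto
      then have "a = (y / x) ^ 2" using x(1) by (simp add: power_divide field_simps)
      then show False using assms(2) by auto
    qed
    then show "z \<in> ?N" using x a0 by auto
  qed
  have "inj_on ((*) a) ?S" using a0 by (auto simp: inj_on_def)
  then have "card ((*) a ` ?S) = card ?S" by (rule card_image)
  moreover have "card ((*) a ` ?S) \<le> card ?N"
    using scaled fin by (intro card_mono) auto
  ultimately have "(*) a ` ?S = ?N"
    using scaled fin \<open>card ?N \<le> card ?S\<close> by (intro card_subset_eq) auto
  moreover have "b \<in> ?N" using assms(3) by auto
  ultimately have "b \<in> (*) a ` ?S" by simp
  then obtain x where "b = a * x ^ 2" by auto
  then have "a * b = (a * x) ^ 2" by (simp add: power2_eq_square)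
  then show ?thesis by (rule is_nth_powerI)
qed

lemma is_square_mult_iff:
  fixes a b :: "'k::field"
  assumes "finite (UNIV :: 'k set)" and "a \<noteq> 0" and "b \<noteq> 0"
  shows "is_square (a * b) \<longleftrightarrow> (is_square a \<longleftrightarrow> is_square b)"
proof (cases "is_square a")
  case False
  have "\<not> is_square (a * b)" if "is_square b"
    using False that assms(3) is_square_mult_cancel_left[of b a] by (simp add: mult.commute)
  then show ?thesis using False nonsquare_mult_nonsquare[OF assms(1) False] by blast
qed (simp add: is_square_mult_cancel_left assms(2))

lemma exists_nonsquare:
  assumes "finite (UNIV :: 'k::field set)" and "odd CHAR('k)"
  shows "\<exists>c::'k. \<not> is_square c"
proof -
  have "(1::'k) \<noteq> - 1"
  proof
    assume "(1::'k) = - 1"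
    then have "of_nat 2 = (0::'k)" by (simp add: eq_neg_iff_add_eq_0)
    then have "CHAR('k) dvd 2" by (simp only: of_nat_eq_0_iff_char_dvd)
    then have "CHAR('k) \<le> 2" by (rule dvd_imp_le) simp
    then show False using assms(2) CHAR_not_1[where 'a='k] by presburger
  qed
  moreover have "(1::'k) ^ 2 = (- 1) ^ 2" by simp
  ultimately have "\<not> inj (\<lambda>x::'k. x ^ 2)" unfolding inj_def by blast
  then have "\<not> surj (\<lambda>x::'k. x ^ 2)" using finite_UNIV_surj_inj assms(1) by blast
  then show ?thesis by (auto simp: is_nth_power_def)
qed

lemma is_square_odd_power:
  fixes c :: "'k::field"
  assumes "odd n" and "c \<noteq> 0" and "is_square (c ^ n)"
  shows "is_square c"
proof -
  obtain m where n: "n = Suc (2 * m)" using assms(1) oddE by (metis Suc_eq_plus1)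
  obtain y where "c ^ n = y ^ 2" using assms(3) by (elim is_nth_powerE)
  moreover have "c ^ n = c * (c ^ m) ^ 2"
    by (simp add: n power_mult power_mult_distrib mult.commute power2_eq_square power_even_eq)
  ultimately have "c = (y / c ^ m) ^ 2" using assms(2) by (simp add: power_divide field_simps)
  then show ?thesis by (rule is_nth_powerI)
qed

lemma is_square_mult_mult_iff:
  fixes a b c :: "'k::field"
  assumes "finite (UNIV :: 'k set)" and "a \<noteq> 0" and "b \<noteq> 0" and "c \<noteq> 0"
  shows "is_square (c * a * b) \<longleftrightarrow> (\<not> is_square b \<longleftrightarrow> (is_square c \<longleftrightarrow> \<not> is_square a))"
  using is_square_mult_iff[OF assms(1), of "c * a" b] is_square_mult_iff[OF assms(1) assms(4,2)] assms
  by auto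

lemma is_square_mult_imp_scale:
  fixes a b c :: "'k::field"
  assumes "a \<noteq> 0" and "b \<noteq> 0" and "c \<noteq> 0" and "is_square (c * a * b)"
  obtains \<mu> where "\<mu> \<noteq> 0" and "\<mu> ^ 2 * b = c * a"
proof -
  obtain w where w: "c * a * b = w ^ 2" using assms(4) by (elim is_nth_powerE)
  then have "w / b \<noteq> 0" using assms(1-3) by auto
  moreover have "(w / b) ^ 2 * b = c * a"
    using w assms(2) by (simp add: power2_eq_square field_simps)
  ultimately show ?thesis by (rule that)
qed

lemma exists_bij_betw_filter:
  assumes "finite B" and "finite C" and "card B = card C"
    and "card {x\<in>B. P x} = card {y\<in>C. Q y}"
  obtains \<sigma> where "bij_betw \<sigma> B C" and "\<forall>x\<in>B. Q (\<sigma> x) \<longleftrightarrow> P x"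
proof -
  have "card {x\<in>B. \<not> P x} = card {y\<in>C. \<not> Q y}"
  proof -
    have "{x\<in>B. \<not> P x} = B - {x\<in>B. P x}" and "{y\<in>C. \<not> Q y} = C - {y\<in>C. Q y}" by auto
    then show ?thesis using assms by (simp add: card_Diff_subset)
  qed
  then obtain g where g: "bij_betw g {x\<in>B. \<not> P x} {y\<in>C. \<not> Q y}"
    using assms(1,2) finite_same_card_bij[of "{x\<in>B. \<not> P x}" "{y\<in>C. \<not> Q y}"] by auto
  obtain f where f: "bij_betw f {x\<in>B. P x} {y\<in>C. Q y}"
    using assms finite_same_card_bij[of "{x\<in>B. P x}" "{y\<in>C. Q y}"] by auto
  define \<sigma> where "\<sigma> x = (if P x then f x else g x)" for x
  have "bij_betw \<sigma> {x\<in>B. P x} {y\<in>C. Q y}"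
    using f by (rule bij_betw_cong[THEN iffD1, rotated]) (simp add: \<sigma>_def)
  moreover have "bij_betw \<sigma> {x\<in>B. \<not> P x} {y\<in>C. \<not> Q y}"
    using g by (rule bij_betw_cong[THEN iffD1, rotated]) (simp add: \<sigma>_def)
  ultimately have "bij_betw \<sigma> ({x\<in>B. P x} \<union> {x\<in>B. \<not> P x}) ({y\<in>C. Q y} \<union> {y\<in>C. \<not> Q y})"
    by (rule bij_betw_combine) auto
  moreover have "\<forall>x\<in>B. Q (\<sigma> x) \<longleftrightarrow> P x"
    using f g by (auto simp: \<sigma>_def bij_betw_def)
  moreover have "{x\<in>B. P x} \<union> {x\<in>B. \<not> P x} = B" and "{y\<in>C. Q y} \<union> {y\<in>C. \<not> Q y} = C" by auto
  ultimately show ?thesis using that by auto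
qed

context
  fixes d :: "'k::field^'n \<Rightarrow> 'k^'n \<Rightarrow> 'k"
  assumes bilinear: "bilinear_form d"
begin

lemma bilinear_form_add_left: "d (u + v) w = d u w + d v w"
  using bilinear by (simp add: bilinear_form_def)

lemma bilinear_form_add_right: "d u (v + w) = d u v + d u w"
  using bilinear by (simp add: bilinear_form_def)

lemma bilinear_form_scale_left: "d (a *s u) v = a * d u v"
  using bilinear by (simp add: bilinear_form_def)

lemma bilinear_form_scale_right: "d u (a *s v) = a * d u v"
  using bilinear by (simp add: bilinear_form_def)

lemma bilinear_form_zero_left: "d 0 v = 0"
  using bilinear_form_scale_left[of 0 0 v] by simp

lemma bilinear_form_zero_right: "d u 0 = 0"
  using bilinear_form_scale_right[of u 0 0] by simp

lemma bilinear_form_expand_left: "d u v = (\<Sum>i\<in>UNIV. u $ i * d (axis i 1) v)"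
proof -
  have "d (\<Sum>i\<in>UNIV. f i) v = (\<Sum>i\<in>UNIV. d (f i) v)" for f :: "'n \<Rightarrow> 'k^'n"
    by (induction rule: finite_induct[OF finite]) (auto simp: bilinear_form_zero_left bilinear_form_add_left)
  from this[of "\<lambda>i. u $ i *s axis i 1"] show ?thesis
    by (simp add: basis_expansion bilinear_form_scale_left)
qed

lemma bilinear_form_expand_right: "d u v = (\<Sum>i\<in>UNIV. v $ i * d u (axis i 1))"
proof -
  have "d u (\<Sum>i\<in>UNIV. f i) = (\<Sum>i\<in>UNIV. d u (f i))" for f :: "'n \<Rightarrow> 'k^'n"
    by (induction rule: finite_induct[OF finite]) (auto simp: bilinear_form_zero_right bilinear_form_add_right)
  from this[of "\<lambda>i. v $ i *s axis i 1"] show ?thesis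
    by (simp add: basis_expansion bilinear_form_scale_right)
qed

lemma bilinear_form_zero_on_span_right:
  assumes "\<forall>y\<in>B. d x y = 0" and "v \<in> vec.span B"
  shows "d x v = 0"
proof -
  have "vec.subspace {v. d x v = 0}"
    by (auto simp: vec.subspace_def bilinear_form_zero_right bilinear_form_add_right
        bilinear_form_scale_right)
  then show ?thesis using vec.span_induct[of v B "\<lambda>v. d x v = 0"] assms by auto
qed

lemma bilinear_form_compose_linear:
  assumes "Vector_Spaces.linear (*s) (*s) \<phi>"
  shows "bilinear_form (\<lambda>u v. d (\<phi> u) (\<phi> v))"
  by (simp add: bilinear_form_def vec.linear_add[OF assms] vec.linear_scale[OF assms]
      bilinear_form_add_left bilinear_form_add_right bilinear_form_scale_left bilinear_form_scale_right)

lemma bilinear_form_scaled: "bilinear_form (\<lambda>u v. c * d u v)"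
  by (simp add: bilinear_form_def bilinear_form_add_left bilinear_form_add_right
      bilinear_form_scale_left bilinear_form_scale_right algebra_simps)

end

lemma bilinear_form_eq_on_spanning_set:
  fixes d e :: "'k::field^'n \<Rightarrow> 'k^'n \<Rightarrow> 'k"
  assumes "bilinear_form d" and "bilinear_form e" and span: "vec.span B = UNIV"
    and on_B: "\<And>x y. x \<in> B \<Longrightarrow> y \<in> B \<Longrightarrow> d x y = e x y"
  shows "d u v = e u v"
proof -
  have right: "d x v = e x v" if "x \<in> B" for x v
  proof -
    have "vec.subspace {v. d x v = e x v}"
      using assms(1,2) by (auto simp: vec.subspace_def bilinear_form_zero_right
          bilinear_form_add_right bilinear_form_scale_right)
    then show ?thesis using vec.span_induct[of v B "\<lambda>v. d x v = e x v"] span on_B that by auto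
  qed
  have "vec.subspace {u. \<forall>v. d u v = e u v}"
    using assms(1,2) by (auto simp: vec.subspace_def bilinear_form_zero_left
        bilinear_form_add_left bilinear_form_scale_left)
  then show ?thesis using vec.span_induct[of u B "\<lambda>u. \<forall>v. d u v = e u v"] span right by auto
qed

definition gram_matrix :: "('k::field^'n \<Rightarrow> 'k^'n \<Rightarrow> 'k) \<Rightarrow> 'k^'n^'n" where
  "gram_matrix d = (\<chi> i j. d (axis i 1) (axis j 1))"

lemma gram_matrix_pullback:
  fixes d :: "'k::field^'n \<Rightarrow> 'k^'n \<Rightarrow> 'k"
  assumes "bilinear_form d"
  shows "transpose (matrix \<phi>) ** gram_matrix d ** matrix \<phi> = gram_matrix (\<lambda>u v. d (\<phi> u) (\<phi> v))"
proof -
  let ?A = "matrix \<phi>" and ?G = "gram_matrix d"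
  have "d (\<phi> (axis i 1)) (\<phi> (axis j 1)) = (transpose ?A ** ?G ** ?A) $ i $ j" for i j
  proof -
    have "d (\<phi> (axis i 1)) (\<phi> (axis j 1)) = (\<Sum>k\<in>UNIV. ?A$k$i * (\<Sum>l\<in>UNIV. ?A$l$j * ?G$k$l))"
      by (subst bilinear_form_expand_left[OF assms], subst bilinear_form_expand_right[OF assms])
        (simp add: matrix_def gram_matrix_def)
    also have "\<dots> = (\<Sum>k\<in>UNIV. \<Sum>l\<in>UNIV. ?A$k$i * ?G$k$l * ?A$l$j)"
      by (simp add: sum_distrib_left mult_ac)
    also have "\<dots> = (\<Sum>l\<in>UNIV. (\<Sum>k\<in>UNIV. ?A$k$i * ?G$k$l) * ?A$l$j)"
      by (subst sum.swap) (simp add: sum_distrib_right)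
    also have "\<dots> = (transpose ?A ** ?G ** ?A) $ i $ j"
      by (simp add: matrix_matrix_mult_def transpose_def)
    finally show ?thesis .
  qed
  then show ?thesis by (simp add: vec_eq_iff gram_matrix_def)
qed

lemma det_gram_matrix_nonzero:
  fixes d :: "'k::field^'n \<Rightarrow> 'k^'n \<Rightarrow> 'k"
  assumes bilinear: "bilinear_form d" and "symmetric_form d" and "nondegenerate_form d"
  shows "det (gram_matrix d) \<noteq> 0"
proof -
  have "x = 0" if "gram_matrix d *v x = 0" for x
  proof -
    have "d (axis i 1) x = (gram_matrix d *v x) $ i" for i
      by (subst bilinear_form_expand_right[OF bilinear])
        (simp add: matrix_vector_mult_def gram_matrix_def mult.commute)
    then have "d u x = 0" for u
      using that by (subst bilinear_form_expand_left[OF bilinear]) simp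
    then show "x = 0" using assms(2,3) by (simp add: symmetric_form_def nondegenerate_form_def)
  qed
  then have "invertible (gram_matrix d)"
    unfolding invertible_left_inverse matrix_left_invertible_ker by blast
  then show ?thesis by (simp add: invertible_det_nz)
qed

lemma Isom_star_multiplier_power_square:
  fixes d :: "'k::field^'n \<Rightarrow> 'k^'n \<Rightarrow> 'k"
  assumes "bilinear_form d" and "symmetric_form d" and "nondegenerate_form d"
    and "(\<phi>, c) \<in> Isom_star d"
  shows "is_square (c ^ CARD('n))"
proof -
  let ?G = "gram_matrix d"
  have "gram_matrix (\<lambda>u v. d (\<phi> u) (\<phi> v)) = (\<chi> i. c *s ?G $ i)"
    using assms(4) by (simp add: Isom_star_def gram_matrix_def vec_eq_iff)
  then have "transpose (matrix \<phi>) ** ?G ** matrix \<phi> = (\<chi> i. c *s ?G $ i)"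
    by (simp add: gram_matrix_pullback[OF assms(1)])
  have "det (transpose (matrix \<phi>) ** ?G ** matrix \<phi>) = det (matrix \<phi>) ^ 2 * det ?G"
    by (simp add: det_mul power2_eq_square)
  also have "det (transpose (matrix \<phi>) ** ?G ** matrix \<phi>) = c ^ CARD('n) * det ?G"
    unfolding \<open>transpose (matrix \<phi>) ** ?G ** matrix \<phi> = _\<close> det_rows_mul by simp
  finally have "c ^ CARD('n) = det (matrix \<phi>) ^ 2"
    using det_gram_matrix_nonzero[OF assms(1-3)] by simp
  then show ?thesis by (rule is_nth_powerI)
qed

lemma orthogonal_basis_finite: "orthogonal_basis d B \<Longrightarrow> finite B"
  by (simp add: orthogonal_basis_def vec.finiteI_independent)

lemma orthogonal_basis_card:
  fixes d :: "'k::field^'n \<Rightarrow> 'k^'n \<Rightarrow> 'k"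
  shows "orthogonal_basis d B \<Longrightarrow> card B = CARD('n)"
  using vec.basis_card_eq_dim[of B UNIV] vec_dim_card by (auto simp: orthogonal_basis_def)

lemma orthogonal_basis_anisotropic:
  assumes "bilinear_form d" and "nondegenerate_form d" and "orthogonal_basis d B" and "x \<in> B"
  shows "d x x \<noteq> 0"
proof
  assume "d x x = 0"
  then have "\<forall>y\<in>B. d x y = 0" using assms(3,4) by (auto simp: orthogonal_basis_def)
  then have "d x v = 0" for v
    using bilinear_form_zero_on_span_right[OF assms(1), of B x v] assms(3) by (auto simp: orthogonal_basis_def)
  then have "x = 0" using assms(2) by (simp add: nondegenerate_form_def)
  then show False using assms(3,4) vec.dependent_zero by (auto simp: orthogonal_basis_def)
qed

lemma bij_betw_basis_lines:
  assumes "orthogonal_basis d B"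
  shows "bij_betw (\<lambda>x. vec.span {x}) B (basis_lines B)"
proof -
  have "x = y" if "x \<in> B" "y \<in> B" "vec.span {x} = vec.span {y}" for x y
  proof (rule ccontr)
    assume "x \<noteq> y"
    then have "x \<in> vec.span (B - {x})"
      using that vec.span_superset[of "{x}"] vec.span_mono[of "{y}" "B - {x}"] by auto
    then show False using assms that(1) by (auto simp: orthogonal_basis_def vec.dependent_def)
  qed
  then show ?thesis by (auto simp: bij_betw_def inj_on_def basis_lines_def)
qed

lemma address_nonsquares_eq: "address_nonsquares d B = card {x\<in>B. \<not> is_square (d x x)}"
  by (simp add: address_nonsquares_def is_nth_power_def)

lemma address_nonsquares_le:
  fixes d :: "'k::field^'n \<Rightarrow> 'k^'n \<Rightarrow> 'k"
  assumes "orthogonal_basis d B"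
  shows "address_nonsquares d B \<le> CARD('n)"
  using card_mono[OF orthogonal_basis_finite[OF assms], of "{x\<in>B. \<not> is_square (d x x)}"]
  by (auto simp: address_nonsquares_eq orthogonal_basis_card[OF assms])

lemma card_twisted_square_class:
  fixes d :: "'k::field^'n \<Rightarrow> 'k^'n \<Rightarrow> 'k"
  assumes "orthogonal_basis d B"
  shows "card {x\<in>B. is_square c \<longleftrightarrow> \<not> is_square (d x x)} =
    (if is_square c then address_nonsquares d B else CARD('n) - address_nonsquares d B)"
proof -
  have "{x\<in>B. is_square (d x x)} = B - {x\<in>B. \<not> is_square (d x x)}" by auto
  then have "card {x\<in>B. is_square (d x x)} = CARD('n) - address_nonsquares d B"
    using orthogonal_basis_finite[OF assms] orthogonal_basis_card[OF assms]
    by (simp add: card_Diff_subset address_nonsquares_eq)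
  then show ?thesis by (simp add: address_nonsquares_eq)
qed

lemma Isom_star_lines_bij:
  assumes "orthogonal_basis d B" and "orthogonal_basis d C" and "(\<phi>, c) \<in> Isom_star d"
    and lines: "(\<lambda>L. \<phi> ` L) ` basis_lines B = basis_lines C"
  obtains \<sigma> where "bij_betw \<sigma> B C" and "\<And>x. x \<in> B \<Longrightarrow> \<phi> x \<in> vec.span {\<sigma> x}"
proof -
  let ?line = "\<lambda>x. vec.span {x}"
  have "inj \<phi>" using assms(3) by (simp add: Isom_star_def bij_def)
  then have "bij_betw (image \<phi>) (basis_lines B) (basis_lines C)"
    using lines by (auto simp: bij_betw_def inj_on_def inj_image_eq_iff)
  then have "bij_betw (inv_into C ?line \<circ> image \<phi> \<circ> ?line) B C"
    using bij_betw_basis_lines[OF assms(1)] bij_betw_basis_lines[OF assms(2)]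
    by (blast intro: bij_betw_trans bij_betw_inv_into)
  moreover have "\<phi> x \<in> ?line ((inv_into C ?line \<circ> image \<phi> \<circ> ?line) x)" if "x \<in> B" for x
  proof -
    have "\<phi> ` ?line x \<in> (\<lambda>L. \<phi> ` L) ` basis_lines B" using that by (simp add: basis_lines_def)
    then have "\<phi> ` ?line x \<in> ?line ` C" using lines by (simp add: basis_lines_def)
    then have "?line ((inv_into C ?line \<circ> image \<phi> \<circ> ?line) x) = \<phi> ` ?line x"
      using f_inv_into_f[of "\<phi> ` ?line x" ?line C] by simp
    then show ?thesis by (simp add: vec.span_base)
  qed
  ultimately show ?thesis using that by blast
qed

lemma similitude_square_class:
  assumes "bilinear_form d" and "d (\<phi> x) (\<phi> x) = c * d x x" and "\<phi> x \<in> vec.span {y}"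
  shows "is_square (c * d x x * d y y)"
proof -
  obtain l where "\<phi> x = l *s y" using assms(3) by (auto simp: vec.span_singleton)
  then have "c * d x x = l ^ 2 * d y y"
    using assms(2) by (simp add: bilinear_form_scale_left[OF assms(1)]
        bilinear_form_scale_right[OF assms(1)] power2_eq_square mult.assoc)
  then have "c * d x x * d y y = (l * d y y) ^ 2" by (simp add: power2_eq_square)
  then show ?thesis by (rule is_nth_powerI)
qed

lemma Isom_star_lines_address:
  fixes d :: "'k::field^'n \<Rightarrow> 'k^'n \<Rightarrow> 'k"
  assumes fin: "finite (UNIV :: 'k set)" and "bilinear_form d" and "nondegenerate_form d"
    and obB: "orthogonal_basis d B" and obC: "orthogonal_basis d C"
    and iso: "(\<phi>, c) \<in> Isom_star d" and "(\<lambda>L. \<phi> ` L) ` basis_lines B = basis_lines C"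
  shows "address_nonsquares d C =
    (if is_square c then address_nonsquares d B else CARD('n) - address_nonsquares d B)"
proof -
  obtain \<sigma> where \<sigma>: "bij_betw \<sigma> B C" and line: "\<And>x. x \<in> B \<Longrightarrow> \<phi> x \<in> vec.span {\<sigma> x}"
    using Isom_star_lines_bij[OF obB obC assms(6,7)] by blast
  have "\<not> is_square (d (\<sigma> x) (\<sigma> x)) \<longleftrightarrow> (is_square c \<longleftrightarrow> \<not> is_square (d x x))" if "x \<in> B" for x
  proof -
    have "\<sigma> x \<in> C" using \<sigma> that by (auto simp: bij_betw_def)
    then have "d x x \<noteq> 0" and "d (\<sigma> x) (\<sigma> x) \<noteq> 0"
      using orthogonal_basis_anisotropic[OF assms(2,3)] obB obC that by auto
    moreover have "c \<noteq> 0" and "d (\<phi> x) (\<phi> x) = c * d x x"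
      using iso by (simp_all add: Isom_star_def)
    moreover note similitude_square_class[where \<phi>=\<phi> and x=x and y="\<sigma> x", OF assms(2)]
    ultimately show ?thesis
      using is_square_mult_mult_iff[OF fin] line[OF that] by simp
  qed
  then have "{y\<in>C. \<not> is_square (d y y)} = \<sigma> ` {x\<in>B. is_square c \<longleftrightarrow> \<not> is_square (d x x)}"
    using \<sigma> by (auto simp: bij_betw_def)
  moreover have "inj_on \<sigma> {x\<in>B. is_square c \<longleftrightarrow> \<not> is_square (d x x)}"
    using \<sigma> by (auto simp: bij_betw_def intro: inj_on_subset)
  ultimately show ?thesis
    by (simp add: address_nonsquares_eq card_image card_twisted_square_class[OF obB, symmetric])
qed

lemma Isom_star_if_on_basis:
  fixes d :: "'k::field^'n \<Rightarrow> 'k^'n \<Rightarrow> 'k"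
  assumes bilinear: "bilinear_form d" and "nondegenerate_form d" and "c \<noteq> 0"
    and linear: "Vector_Spaces.linear (*s) (*s) \<phi>" and span: "vec.span B = UNIV"
    and on_basis: "\<And>x y. x \<in> B \<Longrightarrow> y \<in> B \<Longrightarrow> d (\<phi> x) (\<phi> y) = c * d x y"
  shows "(\<phi>, c) \<in> Isom_star d"
proof -
  have form: "d (\<phi> u) (\<phi> v) = c * d u v" for u v
    by (rule bilinear_form_eq_on_spanning_set[OF bilinear_form_compose_linear[OF bilinear linear]
          bilinear_form_scaled[OF bilinear] span on_basis])
  have "inj \<phi>"
    unfolding vec.linear_inj_iff_eq_0[OF linear]
  proof (intro allI impI)
    fix u assume "\<phi> u = 0"
    then have "d u v = 0" for v
      using form[of u v] bilinear_form_zero_left[OF bilinear] \<open>c \<noteq> 0\<close> by simp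
    then show "u = 0" using assms(2) by (simp add: nondegenerate_form_def)
  qed
  then have "bij \<phi>" using vec.linear_inj_imp_surj[OF linear] by (simp add: bij_def)
  then show ?thesis using linear form \<open>c \<noteq> 0\<close> by (simp add: Isom_star_def)
qed

lemma Isom_star_lines_rescaled:
  fixes d :: "'k::field^'n \<Rightarrow> 'k^'n \<Rightarrow> 'k"
  assumes bilinear: "bilinear_form d" and "nondegenerate_form d"
    and obB: "orthogonal_basis d B" and obC: "orthogonal_basis d C"
    and "c \<noteq> 0" and \<sigma>: "bij_betw \<sigma> B C"
    and \<mu>: "\<And>x. x \<in> B \<Longrightarrow> \<mu> x \<noteq> 0 \<and> \<mu> x ^ 2 * d (\<sigma> x) (\<sigma> x) = c * d x x"
  shows "\<exists>\<phi>. (\<phi>, c) \<in> Isom_star d \<and> (\<lambda>L. \<phi> ` L) ` basis_lines B = basis_lines C"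
proof -
  have \<sigma>C: "\<sigma> x \<in> C" if "x \<in> B" for x using \<sigma> that by (auto simp: bij_betw_def)
  have indep: "vec.independent B" and span: "vec.span B = UNIV"
    using obB by (auto simp: orthogonal_basis_def)
  define \<phi> where "\<phi> = vec.construct B (\<lambda>x. \<mu> x *s \<sigma> x)"
  have linear: "Vector_Spaces.linear (*s) (*s) \<phi>"
    unfolding \<phi>_def by (rule vec.linear_construct[OF indep])
  have \<phi>B: "\<phi> x = \<mu> x *s \<sigma> x" if "x \<in> B" for x
    unfolding \<phi>_def using vec.construct_basis[OF indep that] .
  have "d (\<phi> x) (\<phi> y) = c * d x y" if "x \<in> B" "y \<in> B" for x y
  proof (cases "x = y")
    case True
    then show ?thesis using \<mu>[OF that(2)]
      by (simp add: \<phi>B[OF that(2)] bilinear_form_scale_left[OF bilinear]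
          bilinear_form_scale_right[OF bilinear] power2_eq_square mult.assoc)
  next
    case False
    then have "\<sigma> x \<noteq> \<sigma> y" using \<sigma> that by (auto simp: bij_betw_def inj_on_def)
    then have "d (\<sigma> x) (\<sigma> y) = 0" and "d x y = 0"
      using False that obB obC \<sigma>C by (auto simp: orthogonal_basis_def)
    then show ?thesis
      by (simp add: \<phi>B that bilinear_form_scale_left[OF bilinear] bilinear_form_scale_right[OF bilinear])
  qed
  then have "(\<phi>, c) \<in> Isom_star d"
    using Isom_star_if_on_basis[OF assms(1,2,5) linear span] by blast
  moreover have "\<phi> ` vec.span {x} = vec.span {\<sigma> x}" if "x \<in> B" for x
    using vec.linear_span_image[OF linear, of "{x}"] vec.span_image_scale[of "{\<sigma> x}" "\<lambda>_. \<mu> x"]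
      \<phi>B[OF that] conjunct1[OF \<mu>[OF that]] by simp
  then have "(\<lambda>L. \<phi> ` L) ` basis_lines B = (\<lambda>y. vec.span {y}) ` \<sigma> ` B"
    unfolding basis_lines_def image_image by (rule image_cong[OF refl])
  then have "(\<lambda>L. \<phi> ` L) ` basis_lines B = basis_lines C"
    using \<sigma> by (simp add: basis_lines_def bij_betw_def)
  ultimately show ?thesis by blast
qed

lemma Isom_star_lines_exists:
  fixes d :: "'k::field^'n \<Rightarrow> 'k^'n \<Rightarrow> 'k"
  assumes "bilinear_form d" and "nondegenerate_form d"
    and obB: "orthogonal_basis d B" and obC: "orthogonal_basis d C"
    and "c \<noteq> 0" and \<sigma>: "bij_betw \<sigma> B C"
    and square: "\<And>x. x \<in> B \<Longrightarrow> is_square (c * d x x * d (\<sigma> x) (\<sigma> x))"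
  shows "\<exists>\<phi>. (\<phi>, c) \<in> Isom_star d \<and> (\<lambda>L. \<phi> ` L) ` basis_lines B = basis_lines C"
proof -
  have "\<forall>x\<in>B. \<exists>m. m \<noteq> 0 \<and> m ^ 2 * d (\<sigma> x) (\<sigma> x) = c * d x x"
  proof
    fix x assume x: "x \<in> B"
    then have \<sigma>x: "\<sigma> x \<in> C" using \<sigma> by (auto simp: bij_betw_def)
    have "d x x \<noteq> 0" and "d (\<sigma> x) (\<sigma> x) \<noteq> 0"
      using orthogonal_basis_anisotropic[OF assms(1,2)] obB obC \<sigma>x x by auto
    then obtain m where "m \<noteq> 0" and "m ^ 2 * d (\<sigma> x) (\<sigma> x) = c * d x x"
      by (rule is_square_mult_imp_scale[OF _ _ \<open>c \<noteq> 0\<close> square[OF x]])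
    then show "\<exists>m. m \<noteq> 0 \<and> m ^ 2 * d (\<sigma> x) (\<sigma> x) = c * d x x" by blast
  qed
  then obtain \<mu> where "\<And>x. x \<in> B \<Longrightarrow> \<mu> x \<noteq> 0 \<and> \<mu> x ^ 2 * d (\<sigma> x) (\<sigma> x) = c * d x x"
    by (metis bchoice)
  then show ?thesis by (rule Isom_star_lines_rescaled[OF assms(1-6)])
qed

lemma Isom_star_lines_iff_address:
  fixes d :: "'k::field^'n \<Rightarrow> 'k^'n \<Rightarrow> 'k"
  assumes fin: "finite (UNIV :: 'k set)" and "bilinear_form d" and "nondegenerate_form d"
    and obB: "orthogonal_basis d B" and obC: "orthogonal_basis d C" and "c \<noteq> 0"
  shows "(\<exists>\<phi>. (\<phi>, c) \<in> Isom_star d \<and> (\<lambda>L. \<phi> ` L) ` basis_lines B = basis_lines C) \<longleftrightarrow>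
    address_nonsquares d C =
      (if is_square c then address_nonsquares d B else CARD('n) - address_nonsquares d B)"
    (is "?similar \<longleftrightarrow> ?address")
proof
  show "?similar \<Longrightarrow> ?address" using Isom_star_lines_address[OF assms(1-5)] by blast
next
  assume ?address
  then have count: "card {x\<in>B. is_square c \<longleftrightarrow> \<not> is_square (d x x)} = card {y\<in>C. \<not> is_square (d y y)}"
    by (simp add: card_twisted_square_class[OF obB] address_nonsquares_eq)
  have "card B = card C" by (simp add: orthogonal_basis_card[OF obB] orthogonal_basis_card[OF obC])
  obtain \<sigma> where \<sigma>: "bij_betw \<sigma> B C"
    and classes: "\<forall>x\<in>B. \<not> is_square (d (\<sigma> x) (\<sigma> x)) \<longleftrightarrow> (is_square c \<longleftrightarrow> \<not> is_square (d x x))"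
    using exists_bij_betw_filter[OF orthogonal_basis_finite[OF obB] orthogonal_basis_finite[OF obC]
        \<open>card B = card C\<close> count] by blast
  show ?similar
  proof (rule Isom_star_lines_exists[OF assms(2-6) \<sigma>])
    fix x assume x: "x \<in> B"
    then have "\<sigma> x \<in> C" using \<sigma> by (auto simp: bij_betw_def)
    then have "d x x \<noteq> 0" and "d (\<sigma> x) (\<sigma> x) \<noteq> 0"
      using orthogonal_basis_anisotropic[OF assms(2,3)] obB obC x by auto
    then show "is_square (c * d x x * d (\<sigma> x) (\<sigma> x))"
      using is_square_mult_mult_iff[OF fin _ _ \<open>c \<noteq> 0\<close>] classes x by simp
  qed
qed

(* No parity assumption is needed: in odd dimension the next lemma shows that the second
   alternative can only hold together with the first. *)
lemma exists_Isom_star_lines_iff_address: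
  fixes d :: "'k::field^'n \<Rightarrow> 'k^'n \<Rightarrow> 'k"
  assumes "finite (UNIV :: 'k set)" and "odd CHAR('k)" and "bilinear_form d" and "nondegenerate_form d"
    and obB: "orthogonal_basis d B" and obC: "orthogonal_basis d C"
  shows "(\<exists>\<phi> c. (\<phi>, c) \<in> Isom_star d \<and> (\<lambda>L. \<phi> ` L) ` basis_lines B = basis_lines C) \<longleftrightarrow>
    address_nonsquares d B = address_nonsquares d C \<or>
    address_nonsquares d B = CARD('n) - address_nonsquares d C"
    (is "?similar \<longleftrightarrow> ?s = ?r \<or> ?s = ?n - ?r")
proof -
  have "?r = ?n - ?s \<longleftrightarrow> ?s = ?n - ?r"
    using address_nonsquares_le[OF obB] address_nonsquares_le[OF obC] by linarith
  note similar_iff = Isom_star_lines_iff_address[OF assms(1,3-6)]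
  obtain c :: 'k where "\<not> is_square c" using exists_nonsquare[OF assms(1,2)] by blast
  then have "c \<noteq> 0" by auto
  show ?thesis
  proof
    assume ?similar
    then obtain \<phi> c' where iso: "(\<phi>, c') \<in> Isom_star d"
      and "(\<lambda>L. \<phi> ` L) ` basis_lines B = basis_lines C" by blast
    moreover have "c' \<noteq> 0" using iso by (simp add: Isom_star_def)
    ultimately have "?r = (if is_square c' then ?s else ?n - ?s)"
      using similar_iff[of c'] by blast
    then show "?s = ?r \<or> ?s = ?n - ?r"
      using \<open>?r = ?n - ?s \<longleftrightarrow> ?s = ?n - ?r\<close> by (auto split: if_splits)
  next
    assume "?s = ?r \<or> ?s = ?n - ?r"
    then have "?r = (if is_square 1 then ?s else ?n - ?s) \<or> ?r = (if is_square c then ?s else ?n - ?s)"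
      using \<open>\<not> is_square c\<close> \<open>?r = ?n - ?s \<longleftrightarrow> ?s = ?n - ?r\<close> by auto
    then show ?similar using similar_iff[of 1] similar_iff[OF \<open>c \<noteq> 0\<close>] by auto
  qed
qed

lemma exists_Isom_star_lines_iff_address_odd_dim:
  fixes d :: "'k::field^'n \<Rightarrow> 'k^'n \<Rightarrow> 'k"
  assumes "finite (UNIV :: 'k set)" and "bilinear_form d" and "symmetric_form d"
    and "nondegenerate_form d" and "odd CARD('n)"
    and "orthogonal_basis d B" and "orthogonal_basis d C"
  shows "(\<exists>\<phi> c. (\<phi>, c) \<in> Isom_star d \<and> (\<lambda>L. \<phi> ` L) ` basis_lines B = basis_lines C) \<longleftrightarrow>
    address_nonsquares d B = address_nonsquares d C"
    (is "?similar \<longleftrightarrow> ?s = ?r")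
proof
  assume ?similar
  then obtain \<phi> c where iso: "(\<phi>, c) \<in> Isom_star d"
    and "(\<lambda>L. \<phi> ` L) ` basis_lines B = basis_lines C" by blast
  moreover have "c \<noteq> 0" using iso by (simp add: Isom_star_def)
  moreover have "is_square c"
    using is_square_odd_power[OF assms(5) \<open>c \<noteq> 0\<close>]
      Isom_star_multiplier_power_square[OF assms(2-4) iso] .
  ultimately show "?s = ?r"
    using Isom_star_lines_iff_address[OF assms(1,2,4,6,7) \<open>c \<noteq> 0\<close>] by auto
next
  assume "?s = ?r"
  then show ?similar using Isom_star_lines_iff_address[OF assms(1,2,4,6,7), of 1] by auto
qed

theorem corollary6p4:
  fixes d :: "'k::field^'n \<Rightarrow> 'k^'n \<Rightarrow> 'k"
    and B C :: "('k^'n) set" and s r n :: nat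
  assumes "finite (UNIV :: 'k set)"
    and "odd CHAR('k)"
    and "bilinear_form d" and "symmetric_form d" and "nondegenerate_form d"
    and "n = CARD('n)"
    and "orthogonal_basis d B" and "orthogonal_basis d C"
    and "s = address_nonsquares d B" and "r = address_nonsquares d C"
  shows "(odd n \<longrightarrow>
            ((\<exists>\<phi> c. (\<phi>, c) \<in> Isom_star d \<and> (\<lambda>L. \<phi> ` L) ` basis_lines B = basis_lines C)
             \<longleftrightarrow> s = r))
       \<and> (even n \<longrightarrow>
            ((\<exists>\<phi> c. (\<phi>, c) \<in> Isom_star d \<and> (\<lambda>L. \<phi> ` L) ` basis_lines B = basis_lines C)
             \<longleftrightarrow> s = r \<or> s = n - r))"
  using exists_Isom_star_lines_iff_address[OF assms(1-3,5,7,8)]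
    exists_Isom_star_lines_iff_address_odd_dim[OF assms(1,3-5) _ assms(7,8)]
  unfolding assms(6,9,10) by blast

end
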